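(* Let $n$ and $\ell$ be non-negative integers with $n\geq \ell$, let $q$ be a prime power, and let $\mathcal F\subseteq \mathbb F_q[x]$ be a family of monic polynomials of degree $n$ such that $\deg(\gcd(p_1,p_2))\geq \ell$ for all $p_1,p_2\in\mathcal F$. Then \[ |\mathcal F|\leq q^{n-\ell}. \] Moreover, if $n>2\ell$ and $|\mathcal F|=q^{n-\ell}$, then $\mathcal F$ is trivial, i.e. there is a monic polynomial $g\in\mathbb F_q[x]$ of degree $\ell$ such that $\mathcal F=\{g\cdot p : p\in\mathbb F_q[x] \text{ monic}, \deg(p)=n-\ell\}$, with the sole exception of the case $q=2$, $\ell=1$, $n=3$ and \[ \mathcal F=\{x^2(x+1),\ x(x+1)^2,\ x(x^2+x+1),\ (x+1)(x^2+x+1)\}\subseteq \mathbb F_2[x]. \]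
   Context: $\mathbb F_q$ denotes the finite field with $q$ elements. A family $\mathcal F\subseteq\mathbb F_q[x]$ is called $\ell$-intersecting if every pair of its elements has a common divisor of degree at least $\ell$ (i.e. $\deg\gcd\geq\ell$). *)

theory Defs
  imports
    "HOL-Library.Cardinality"
    "HOL-Computational_Algebra.Computational_Algebra"
begin

text \<open>
  Finite fields are types of class \<open>field_gcd\<close> and \<open>finite\<close>. The class \<open>field_gcd\<close> extends
  \<open>field\<close> only by the canonical, trivial division and gcd operations of a field; it is what
  makes the library \<open>gcd\<close> available on polynomials.
\<close>

definition monic_polys :: "nat \<Rightarrow> 'a::field_gcd poly set" where
  "monic_polys n = {p. lead_coeff p = 1 \<and> degree p = n}"

definition intersecting :: "nat \<Rightarrow> 'a::field_gcd poly set \<Rightarrow> bool" where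
  "intersecting l F \<longleftrightarrow> (\<forall>p\<in>F. \<forall>p'\<in>F. degree (gcd p p') \<ge> l)"

definition trivial_family :: "nat \<Rightarrow> nat \<Rightarrow> 'a::field_gcd poly set \<Rightarrow> bool" where
  "trivial_family n l F \<longleftrightarrow>
     (\<exists>g \<in> monic_polys l. F = {g * p | p. p \<in> monic_polys (n - l)})"

text \<open>
  The variable \<open>x\<close> is \<open>[:0, 1:]\<close>. The definition makes sense over every field, but it is only
  used over a field with two elements.
\<close>

definition exceptional_family :: "'a::field_gcd poly set" where
  "exceptional_family =
     (let x = [:0, 1:] in
       {x ^ 2 * (x + 1), x * (x + 1) ^ 2, x * (x ^ 2 + x + 1), (x + 1) * (x ^ 2 + x + 1)})"

end

theory Submission
  imports Defs
begin

text \<open>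
  Two members of \<open>F\<close> whose difference has degree less than \<open>l\<close> coincide, because their gcd
  divides the difference.  This gives the bound.
  The same argument works for members \<open>f\<close>, \<open>f'\<close> that are congruent modulo a prime polynomial \<open>P\<close>
  of degree \<open>m = n - l\<close> not dividing \<open>f\<close>.  As there are only \<open>q ^ m - 1\<close> nonzero residues, an
  extremal family contains a multiple \<open>g * P\<close>, and when \<open>m > l\<close> every member not divisible by \<open>P\<close>
  is divisible by \<open>g\<close>.  With a second prime \<open>P'\<close> of degree \<open>m\<close> the cofactors \<open>g\<close> agree, and no
  member is divisible by both primes, so the family is trivial.  Two primes of degree \<open>m\<close> exist
  unless \<open>q = m = 2\<close>, where the only prime is \<open>x ^ 2 + x + 1\<close>; this case produces the exception.
\<close>

section \<open>Counting monic polynomials and their monic multiples\<close>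

lemma monic_polysD:
  assumes "p \<in> monic_polys n"
  shows "degree p = n" "coeff p n = 1" "p \<noteq> 0"
  using assms by (auto simp: monic_polys_def)

lemma monic_polys_0: "monic_polys 0 = {1}"
  by (auto simp: monic_polys_def one_pCons elim!: degree_eq_zeroE)

lemma monic_polys_Suc:
  "monic_polys (Suc n) = (\<lambda>(a, p). pCons a p) ` (UNIV \<times> monic_polys n)"
proof (rule set_eqI)
  fix p :: "'a poly"
  show "p \<in> monic_polys (Suc n) \<longleftrightarrow> p \<in> (\<lambda>(a, p). pCons a p) ` (UNIV \<times> monic_polys n)"
    by (cases p rule: pCons_cases) (auto simp: monic_polys_def image_iff)
qed

lemma finite_monic_polys [simp, intro]:
  "finite (monic_polys n :: 'a::{field_gcd, finite} poly set)"
  by (induction n) (auto simp: monic_polys_0 monic_polys_Suc)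

lemma card_monic_polys:
  "card (monic_polys n :: 'a::{field_gcd, finite} poly set) = CARD('a) ^ n"
proof (induction n)
  case (Suc n)
  have "inj_on (\<lambda>(a, p). pCons a p) (UNIV \<times> (monic_polys n :: 'a poly set))"
    by (auto simp: inj_on_def)
  then show ?case
    by (simp add: monic_polys_Suc card_image card_cartesian_product Suc.IH)
qed (simp add: monic_polys_0)

text \<open>The conjunct \<open>l <= n\<close> guards against truncated subtraction: for
  \<open>n < l\<close> the set \<open>monic_polys (n - l)\<close> is \<open>{1}\<close>, not
  empty.\<close>

lemma mult_in_monic_polys_iff:
  assumes "g \<in> monic_polys l"
  shows "g * p \<in> monic_polys n \<longleftrightarrow> l \<le> n \<and> p \<in> monic_polys (n - l)"
proof (cases "p = 0")
  case False
  then have "degree (g * p) = l + degree p"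
    using monic_polysD[OF assms] by (simp add: degree_mult_eq)
  moreover have "lead_coeff (g * p) = lead_coeff p"
    using monic_polysD[OF assms] unfolding lead_coeff_mult by simp
  ultimately show ?thesis
    unfolding monic_polys_def by auto
qed (auto simp: monic_polys_def)

lemma monic_multiples_eq:
  assumes "g \<in> monic_polys l" "l \<le> n"
  shows "{f \<in> monic_polys n. g dvd f} = (*) g ` monic_polys (n - l)"
  using mult_in_monic_polys_iff[OF assms(1)] assms(2) by (auto elim!: dvdE)

lemma card_monic_multiples:
  fixes g :: "'a::{field_gcd, finite} poly"
  assumes "g \<in> monic_polys l" "l \<le> n"
  shows "card {f \<in> monic_polys n. g dvd f} = CARD('a) ^ (n - l)"
proof -
  have "inj_on ((*) g) (monic_polys (n - l))"
    using monic_polysD(3)[OF assms(1)] by (auto simp: inj_on_def)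
  then show ?thesis
    by (simp add: monic_multiples_eq[OF assms] card_image card_monic_polys)
qed

lemma monic_dvd_eq:
  assumes "g \<in> monic_polys n" "h \<in> monic_polys n" "g dvd h"
  shows "g = h"
proof -
  obtain k where k: "h = g * k"
    using assms(3) by (auto elim: dvdE)
  then have "k = 1"
    using mult_in_monic_polys_iff[OF assms(1), of k n] assms(2) by (simp add: monic_polys_0)
  with k show ?thesis by simp
qed

section \<open>Normalization and prime polynomials over a field\<close>

lemma unit_factor_field_gcd [simp]: "unit_factor (c :: 'a::field_gcd) = c"
  by (cases "c = 0")
    (use unit_factor_mult_normalize[of c] in \<open>auto simp: is_unit_normalize dvd_field_iff\<close>)

lemma normalize_poly_eq_smult:
  "normalize p = smult (inverse (lead_coeff p)) (p :: 'a::field_gcd poly)"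
  by (simp add: poly_eq_iff field_simps)

text \<open>A \<open>prime\<close> is required to be normalized, which for polynomials means monic.
  Hence distinct primes are never associated, and counting primes means counting monic irreducible
  polynomials.\<close>

lemma prime_poly_iff:
  fixes p :: "'a::field_gcd poly"
  shows "prime p \<longleftrightarrow> irreducible p \<and> lead_coeff p = 1"
proof -
  have "normalize p = p \<longleftrightarrow> lead_coeff p = 1" if "p \<noteq> 0"
  proof
    assume "normalize p = p"
    then show "lead_coeff p = 1"
      using that by (metis coeff_normalize div_self leading_coeff_neq_0 unit_factor_field_gcd)
  next
    assume "lead_coeff p = 1"
    then show "normalize p = p"
      by (simp add: poly_eq_iff)
  qed
  then show ?thesis
    unfolding prime_def using prime_elem_iff_irreducible[of p] irreducible_def[of p] by auto
qed

lemma prime_degree_pos: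
  fixes p :: "'a::field_gcd poly"
  assumes "prime p"
  shows "degree p > 0"
proof (rule ccontr)
  assume "\<not> degree p > 0"
  then have "is_unit p"
    using assms is_unit_iff_degree[of p] by auto
  with assms show False by simp
qed

section \<open>Factorization by degree and Gauss's formula\<close>

definition prime_polys :: "nat \<Rightarrow> 'a::field_gcd poly set" where
  "prime_polys d = {p. prime p \<and> degree p = d}"

lemma prime_polysD:
  assumes "p \<in> prime_polys d"
  shows "prime p" "degree p = d" "p \<in> monic_polys d" "d > 0"
  using assms prime_degree_pos[of p] by (auto simp: prime_polys_def monic_polys_def prime_poly_iff)

lemma finite_prime_polys [simp, intro]:
  "finite (prime_polys d :: 'a::{field_gcd, finite} poly set)"
  by (rule finite_subset[OF _ finite_monic_polys]) (auto dest: prime_polysD)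

lemma degree_eq_sum_multiplicity:
  fixes f :: "'a::field_gcd poly"
  assumes "f \<noteq> 0"
  shows "degree f = (\<Sum>p \<in> prime_factors f. multiplicity p f * degree p)"
proof -
  have "degree f = degree (normalize f)"
    by (simp add: normalize_poly_eq_smult)
  also have "normalize f = (\<Prod>p \<in> prime_factors f. p ^ multiplicity p f)"
    using prod_prime_factors[OF assms] by simp
  also have "degree \<dots> = (\<Sum>p \<in> prime_factors f. degree (p ^ multiplicity p f))"
    by (intro degree_prod_sum_eq) auto
  also have "\<dots> = (\<Sum>p \<in> prime_factors f. multiplicity p f * degree p)"
    by (intro sum.cong refl) (metis degree_power_eq in_prime_factors_imp_prime not_prime_0)
  finally show ?thesis .
qed

text \<open>Pairs keep the base available. Weighting a pair by \<open>degree p\<close> gives the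
  polynomial analogue of the von Mangoldt function at \<open>p ^ k\<close>, a polynomial of degree
  \<open>m\<close>.\<close>

definition prime_powers :: "nat \<Rightarrow> ('a::field_gcd poly \<times> nat) set" where
  "prime_powers m = {(p, k). prime p \<and> k > 0 \<and> k * degree p = m}"

lemma finite_prime_powers [simp, intro]:
  "finite (prime_powers m :: ('a::{field_gcd, finite} poly \<times> nat) set)"
proof (rule finite_subset)
  show "prime_powers m \<subseteq> (\<Union>d\<le>m. prime_polys d :: 'a poly set) \<times> {..m}"
    using prime_degree_pos by (fastforce simp: prime_powers_def prime_polys_def)
qed auto

lemma prime_powers_disjoint: "i \<noteq> j \<Longrightarrow> prime_powers i \<inter> prime_powers j = {}"
  by (auto simp: prime_powers_def)

text \<open>A prime of multiplicity \<open>e\<close> in \<open>f\<close> contributes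
  \<open>e * degree p\<close>, that is, \<open>degree p\<close> once for each of its powers with
  exponent 1 to \<open>e\<close>. Grouping the powers by their degree \<open>m\<close> prepares the
  summation over all \<open>f\<close>, since the number of multiples of \<open>p ^ k\<close> depends
  on \<open>m\<close> only.\<close>

lemma degree_eq_sum_prime_powers:
  fixes f :: "'a::{field_gcd, finite} poly"
  assumes "f \<noteq> 0"
  shows "degree f = (\<Sum>m\<in>{1..degree f}. \<Sum>(p, k)\<in>prime_powers m. if p ^ k dvd f then degree p else 0)"
proof -
  define S where "S = (\<Union>m\<in>{1..degree f}. prime_powers m :: ('a poly \<times> nat) set)"
  have "finite S" by (simp add: S_def)
  have "degree f = (\<Sum>p \<in> prime_factors f. \<Sum>k\<in>{1..multiplicity p f}. degree p)"
    using degree_eq_sum_multiplicity[OF assms] by simp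
  also have "\<dots> = (\<Sum>(p, k) \<in> (SIGMA p:prime_factors f. {1..multiplicity p f}). degree p)"
    by (rule sum.Sigma) auto
  also have "(SIGMA p:prime_factors f. {1..multiplicity p f}) = {(p, k) \<in> S. p ^ k dvd f}"
  proof (rule set_eqI, clarify)
    fix p :: "'a poly" and k :: nat
    have "prime p \<Longrightarrow> p ^ k dvd f \<longleftrightarrow> k \<le> multiplicity p f"
      using assms by (intro power_dvd_iff_le_multiplicity) auto
    moreover have "p dvd f" if "k > 0" "p ^ k dvd f"
      using that dvd_power[of k p] dvd_trans by blast
    \<comment> \<open>The degree of a prime power dividing \<open>f\<close> lies in this range, so
      the restriction to the finite set \<open>S\<close> loses none of them.\<close>
    moreover have "k * degree p \<in> {1..degree f}" if "prime p" "k > 0" "p ^ k dvd f"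
    proof -
      have "k * degree p = degree (p ^ k)"
        using that by (subst degree_power_eq) auto
      also have "\<dots> \<le> degree f"
        using that assms by (intro dvd_imp_degree_le)
      finally show ?thesis
        using prime_degree_pos[OF that(1)] that(2) by simp
    qed
    ultimately show "(p, k) \<in> (SIGMA p:prime_factors f. {1..multiplicity p f})
        \<longleftrightarrow> (p, k) \<in> {(p, k) \<in> S. p ^ k dvd f}"
      using assms unfolding S_def prime_powers_def by (auto simp: in_prime_factors_iff)
  qed
  also have "(\<Sum>(p, k) \<in> {(p, k) \<in> S. p ^ k dvd f}. degree p)
      = (\<Sum>(p, k) \<in> S. if p ^ k dvd f then degree p else 0)"
    using \<open>finite S\<close> by (intro sum.mono_neutral_cong_left) (auto split: if_splits)
  also have "\<dots> = (\<Sum>m\<in>{1..degree f}. \<Sum>(p, k)\<in>prime_powers m. if p ^ k dvd f then degree p else 0)"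
    unfolding S_def by (intro sum.UNION_disjoint ballI impI prime_powers_disjoint) simp_all
  finally show ?thesis .
qed

lemma prime_power_in_monic_polys:
  assumes "(p, k) \<in> prime_powers m"
  shows "p ^ k \<in> monic_polys m"
proof -
  have "prime p" "m = k * degree p"
    using assms by (auto simp: prime_powers_def)
  moreover from this have "p \<noteq> 0" "lead_coeff (p ^ k) = 1"
    by (auto simp: lead_coeff_power prime_poly_iff)
  ultimately show ?thesis
    unfolding monic_polys_def by (simp add: degree_power_eq)
qed

text \<open>
  Summing the factorization identity for the degree over all monic polynomials of degree \<open>n\<close>
  and subtracting \<open>q\<close> times the result for \<open>n - 1\<close> gives Gauss's formula
  \<open>q ^ n = (\<Sum>d | d dvd n. d * N d)\<close>, where \<open>N d\<close> counts the primes of degree \<open>d\<close>.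
\<close>

lemma sum_degree_prime_powers_convolution:
  "n * CARD('a) ^ n =
     (\<Sum>m\<in>{1..n}. (\<Sum>(p, k)\<in>prime_powers m. degree (p :: 'a::{field_gcd, finite} poly)) * CARD('a) ^ (n - m))"
proof -
  have "n * CARD('a) ^ n = (\<Sum>f\<in>(monic_polys n :: 'a poly set). degree f)"
    by (simp add: card_monic_polys monic_polysD(1))
  also have "\<dots> = (\<Sum>f\<in>(monic_polys n :: 'a poly set). \<Sum>m\<in>{1..n}. \<Sum>(p, k)\<in>prime_powers m.
      if p ^ k dvd f then degree p else 0)"
  proof (rule sum.cong[OF refl])
    fix f :: "'a poly"
    assume "f \<in> monic_polys n"
    then show "degree f = (\<Sum>m\<in>{1..n}. \<Sum>(p, k)\<in>prime_powers m.
        if p ^ k dvd f then degree p else 0)"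
      using degree_eq_sum_prime_powers[of f] monic_polysD(1,3)[of f n] by simp
  qed
  also have "\<dots> = (\<Sum>m\<in>{1..n}. \<Sum>f\<in>(monic_polys n :: 'a poly set). \<Sum>(p, k)\<in>prime_powers m.
      if p ^ k dvd f then degree p else 0)"
    by (rule sum.swap)
  also have "\<dots> = (\<Sum>m\<in>{1..n}. \<Sum>(p, k)\<in>prime_powers m. \<Sum>f\<in>(monic_polys n :: 'a poly set).
      if p ^ k dvd f then degree p else 0)"
    unfolding case_prod_beta by (intro sum.cong refl sum.swap)
  also have "\<dots> = (\<Sum>m\<in>{1..n}. \<Sum>(p, k)\<in>prime_powers m. degree (p :: 'a poly) * CARD('a) ^ (n - m))"
  proof (intro sum.cong refl, clarify)
    fix m k and p :: "'a poly"
    assume m: "m \<in> {1..n}" and pk: "(p, k) \<in> prime_powers m"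
    have "(\<Sum>f\<in>(monic_polys n :: 'a poly set). if p ^ k dvd f then degree p else 0)
        = (\<Sum>f\<in>{f \<in> monic_polys n. p ^ k dvd f}. degree p)"
      by (intro sum.mono_neutral_cong_right) auto
    also have "\<dots> = degree p * CARD('a) ^ (n - m)"
      using card_monic_multiples[OF prime_power_in_monic_polys[OF pk], of n] m by simp
    finally show "(\<Sum>f\<in>(monic_polys n :: 'a poly set). if p ^ k dvd f then degree p else 0)
        = degree p * CARD('a) ^ (n - m)" .
  qed
  also have "\<dots> = (\<Sum>m\<in>{1..n}. (\<Sum>(p, k)\<in>prime_powers m. degree (p :: 'a poly)) * CARD('a) ^ (n - m))"
    by (simp add: sum_distrib_right case_prod_beta)
  finally show ?thesis .
qed

text \<open>Gauss's formula: the exponent is determined by the prime, whose degree \<open>d\<close>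
  can be any divisor of \<open>m\<close>, so the left side is the sum of \<open>d * N d\<close> over
  \<open>d dvd m\<close>.\<close>

lemma sum_degree_prime_powers:
  assumes "m > 0"
  shows "(\<Sum>(p, k)\<in>prime_powers m. degree (p :: 'a::{field_gcd, finite} poly)) = CARD('a) ^ m"
proof -
  define c where "c j = (\<Sum>(p, k)\<in>prime_powers j. degree (p :: 'a poly))" for j
  obtain n where m: "m = Suc n"
    using assms by (cases m) auto
  have "Suc n * CARD('a) ^ Suc n = (\<Sum>j\<in>{1..Suc n}. c j * CARD('a) ^ (Suc n - j))"
    using sum_degree_prime_powers_convolution[of "Suc n"] unfolding c_def .
  also have "\<dots> = (\<Sum>j\<in>{1..n}. c j * CARD('a) ^ (Suc n - j)) + c (Suc n)"
    by simp
  \<comment> \<open>Each term below the top one has a spare factor q; taking it out leaves the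
    convolution for \<open>n\<close>, so the top term is
    \<open>(n + 1) * q ^ (n + 1) - q * n * q ^ n\<close>.\<close>
  also have "(\<Sum>j\<in>{1..n}. c j * CARD('a) ^ (Suc n - j))
      = CARD('a) * (\<Sum>j\<in>{1..n}. c j * CARD('a) ^ (n - j))"
    unfolding sum_distrib_left by (intro sum.cong) (auto simp: Suc_diff_le)
  also have "(\<Sum>j\<in>{1..n}. c j * CARD('a) ^ (n - j)) = n * CARD('a) ^ n"
    using sum_degree_prime_powers_convolution[of n, where 'a = 'a] unfolding c_def by simp
  finally have "c (Suc n) = CARD('a) ^ Suc n"
    by (simp add: algebra_simps)
  then show ?thesis
    by (simp add: c_def m)
qed

section \<open>Existence of two primes of a given degree\<close>

lemma card_prime_polys_le:
  assumes "d > 0"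
  shows "d * card (prime_polys d :: 'a::{field_gcd, finite} poly set) \<le> CARD('a) ^ d"
proof -
  have "d * card (prime_polys d :: 'a poly set) = (\<Sum>(p, k)\<in>(\<lambda>p. (p, 1::nat)) ` (prime_polys d :: 'a poly set). degree p)"
    by (subst sum.reindex) (auto simp: inj_on_def prime_polys_def)
  also have "\<dots> \<le> (\<Sum>(p, k)\<in>prime_powers d. degree (p :: 'a poly))"
    by (intro sum_mono2 finite_prime_powers) (auto simp: prime_powers_def prime_polys_def)
  also have "\<dots> = CARD('a) ^ d"
    by (rule sum_degree_prime_powers[OF assms])
  finally show ?thesis .
qed

text \<open>In Gauss's formula the pairs with exponent 1 account for \<open>m * N m\<close>. Every
  other pair has exponent at least 2, hence a base of degree \<open>d <= m div 2\<close>, and all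
  primes of degree \<open>d\<close> together weigh at most \<open>q ^ d\<close>.\<close>

lemma card_prime_polys_ge:
  assumes "m > 0"
  shows "CARD('a) ^ m \<le> m * card (prime_polys m :: 'a::{field_gcd, finite} poly set)
           + (\<Sum>d\<in>{1..m div 2}. CARD('a) ^ d)"
proof -
  let ?A = "{(p, k) \<in> (prime_powers m :: ('a poly \<times> nat) set). k = 1}"
  let ?B = "{(p, k) \<in> (prime_powers m :: ('a poly \<times> nat) set). k \<noteq> 1}"
  let ?U = "\<Union>d\<in>{1..m div 2}. (prime_polys d :: 'a poly set)"
  have "CARD('a) ^ m = (\<Sum>(p, k)\<in>?A \<union> ?B. degree p)"
    unfolding sum_degree_prime_powers[OF assms, where 'a = 'a, symmetric]
    by (rule arg_cong[where f = "sum _"]) auto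
  also have "\<dots> = (\<Sum>(p, k)\<in>?A. degree p) + (\<Sum>(p, k)\<in>?B. degree p)"
    by (intro sum.union_disjoint) (auto intro: finite_subset[OF _ finite_prime_powers])
  also have "?A = (\<lambda>p. (p, 1::nat)) ` (prime_polys m :: 'a poly set)"
    by (auto simp: prime_powers_def prime_polys_def)
  also have "(\<Sum>(p, k)\<in>\<dots>. degree p) = m * card (prime_polys m :: 'a poly set)"
    by (subst sum.reindex) (auto simp: inj_on_def prime_polys_def)
  \<comment> \<open>As primes have positive degree, \<open>k * degree p = m\<close> determines
    \<open>k\<close> from \<open>p\<close>.\<close>
  also have "(\<Sum>(p, k)\<in>?B. degree p) = (\<Sum>p\<in>fst ` ?B. degree p)"
  proof (subst sum.reindex)
    show "inj_on fst ?B"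
      using prime_degree_pos by (fastforce simp: inj_on_def prime_powers_def)
  qed (auto simp: case_prod_beta)
  also have "\<dots> \<le> (\<Sum>p\<in>?U. degree p)"
  proof (intro sum_mono2)
    have "degree p \<in> {1..m div 2}" if "prime p" "k > 0" "k \<noteq> 1" "k * degree p = m"
      for p :: "'a poly" and k
    proof -
      have "2 * degree p \<le> k * degree p"
        using that by (intro mult_right_mono) auto
      then show ?thesis
        using that prime_degree_pos[of p] by auto
    qed
    then show "fst ` ?B \<subseteq> ?U"
      by (auto simp: prime_powers_def prime_polys_def)
  qed auto
  also have "(\<Sum>p\<in>?U. degree p) = (\<Sum>d\<in>{1..m div 2}. \<Sum>p\<in>(prime_polys d :: 'a poly set). degree p)"
    by (intro sum.UNION_disjoint ballI impI finite_prime_polys) (auto simp: prime_polys_def)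
  also have "\<dots> \<le> (\<Sum>d\<in>{1..m div 2}. CARD('a) ^ d)"
  proof (intro sum_mono)
    fix d assume "d \<in> {1..m div 2}"
    moreover have "(\<Sum>p\<in>(prime_polys d :: 'a poly set). degree p) = d * card (prime_polys d :: 'a poly set)"
      by (simp add: prime_polys_def)
    ultimately show "(\<Sum>p\<in>(prime_polys d :: 'a poly set). degree p) \<le> CARD('a) ^ d"
      using card_prime_polys_le[of d, where 'a = 'a] by simp
  qed
  finally show ?thesis by simp
qed

lemma sum_powers_le:
  fixes q :: nat
  assumes "q \<ge> 2"
  shows "(\<Sum>d\<in>{1..k}. q ^ d) + 2 \<le> 2 * q ^ k"
proof (induction k)
  case (Suc k)
  have "(\<Sum>d\<in>{1..Suc k}. q ^ d) = (\<Sum>d\<in>{1..k}. q ^ d) + q ^ Suc k"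
    by simp
  moreover have "2 * q ^ k \<le> q ^ Suc k"
    using assms by simp
  ultimately show ?case
    using Suc by linarith
qed simp

lemma CARD_field_ge_2: "CARD('a::{field_gcd, finite}) \<ge> 2"
proof -
  have "card {0, 1 :: 'a} \<le> CARD('a)"
    by (intro card_mono) auto
  then show ?thesis by simp
qed

lemma two_prime_polys:
  assumes "m > 0" "\<not> (CARD('a) = 2 \<and> m = 2)"
  shows "card (prime_polys m :: 'a::{field_gcd, finite} poly set) \<ge> 2"
proof (rule ccontr)
  define q where "q = CARD('a)"
  have q: "q \<ge> 2"
    unfolding q_def by (rule CARD_field_ge_2)
  assume "\<not> card (prime_polys m :: 'a poly set) \<ge> 2"
  then have "m * card (prime_polys m :: 'a poly set) \<le> m"
    by (cases "card (prime_polys m :: 'a poly set)") auto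
  \<comment> \<open>With at most one prime of degree \<open>m\<close>, the left side has order
    \<open>q ^ m\<close> but the right side only \<open>q ^ (m div 2)\<close>, so only small cases
    need care.\<close>
  then have le: "q ^ m \<le> m + (\<Sum>d\<in>{1..m div 2}. q ^ d)"
    using card_prime_polys_ge[OF assms(1), where 'a = 'a] unfolding q_def by linarith
  consider "m = 1" | "m = 2" | "m \<ge> 3"
    using assms(1) by linarith
  then show False
  proof cases
    case 1
    then show False using le q by simp
  next
    case 2
    then have "q * q \<le> 2 + q" "q \<ge> 3"
      using le assms(2) q by (auto simp: power2_eq_square q_def)
    moreover have "3 * q \<le> q * q"
      using \<open>q \<ge> 3\<close> by simp
    ultimately show False by linarith
  next
    case 3
    \<comment> \<open>From \<open>m - k >= 2\<close> the left side of \<open>le\<close> is at least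
      \<open>4 * q ^ k\<close>, while its right side is at most \<open>m + 2 * q ^ k - 2\<close>. So
      \<open>2 * q ^ k + 2 <= m <= 2 * k + 1\<close>, contradicting
      \<open>k < q ^ k\<close>.\<close>
    define k where "k = m div 2"
    have "m - k \<ge> 2" and m: "m \<le> 2 * k + 1"
      using 3 by (auto simp: k_def)
    have "4 \<le> q ^ 2"
      using power_mono[of 2 q 2] q by simp
    also have "q ^ 2 \<le> q ^ (m - k)"
      using \<open>m - k \<ge> 2\<close> q by (intro power_increasing) auto
    finally have "4 * q ^ k \<le> q ^ (m - k) * q ^ k"
      by (rule mult_right_mono) simp
    also have "\<dots> = q ^ m"
      by (simp flip: power_add add: k_def)
    also have "\<dots> + 2 \<le> m + 2 * q ^ k"
      using le sum_powers_le[OF q, of k] by (simp add: k_def)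
    finally have "2 * q ^ k + 2 \<le> m" by simp
    moreover have "k < q ^ k"
      using q by (intro less_exp[THEN less_le_trans] power_mono) auto
    ultimately show False using m by linarith
  qed
qed

section \<open>The upper bound\<close>

lemma monic_polys_add:
  assumes "f \<in> monic_polys n" "r = 0 \<or> degree r < n"
  shows "f + r \<in> monic_polys n"
proof (cases "r = 0")
  case False
  then have "degree (f + r) = n" "coeff r n = 0"
    using assms monic_polysD[OF assms(1)] by (auto simp: degree_add_eq_left coeff_eq_0)
  then show ?thesis
    using monic_polysD[OF assms(1)] by (simp add: monic_polys_def)
qed (use assms in simp)

lemma degree_diff_monic_polys:
  assumes "f \<in> monic_polys n" "f' \<in> monic_polys n" "f \<noteq> f'"
  shows "degree (f - f') < n"
proof -
  have "degree (f - f') \<le> n"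
    using monic_polysD(1)[OF assms(1)] monic_polysD(1)[OF assms(2)] by (intro degree_diff_le) auto
  moreover have "coeff (f - f') n = 0"
    using monic_polysD(2)[OF assms(1)] monic_polysD(2)[OF assms(2)] by simp
  moreover have "lead_coeff (f - f') \<noteq> 0"
    using assms(3) unfolding leading_coeff_0_iff by simp
  ultimately show ?thesis
    by (cases "degree (f - f') = n") auto
qed

text \<open>The gcd of \<open>f\<close> and \<open>f'\<close> divides \<open>h * r\<close> and is
  coprime to \<open>h\<close>, so it divides \<open>r\<close>, which is too small unless it
  vanishes. The bound takes \<open>h = 1\<close>; the extremal case takes a prime for
  \<open>h\<close>.\<close>

lemma intersecting_eqI:
  assumes "intersecting l F" "f \<in> F" "f' \<in> F" "coprime f h"
    and diff: "f - f' = h * r" and r: "r = 0 \<or> degree r < l"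
  shows "f = f'"
proof (rule ccontr)
  assume "f \<noteq> f'"
  then have "r \<noteq> 0"
    using diff by auto
  have "gcd f f' dvd f - f'"
    by (intro dvd_diff) auto
  moreover have "coprime (gcd f f') h"
    using assms(4) by (rule coprime_divisors[OF gcd_dvd1 dvd_refl])
  ultimately have "gcd f f' dvd r"
    unfolding diff by (simp add: coprime_dvd_mult_right_iff)
  then have "degree (gcd f f') \<le> degree r"
    using \<open>r \<noteq> 0\<close> by (rule dvd_imp_degree_le)
  moreover have "l \<le> degree (gcd f f')"
    using assms(1-3) by (simp add: intersecting_def)
  ultimately show False
    using r \<open>r \<noteq> 0\<close> by simp
qed

lemma card_intersecting_le:
  fixes F :: "'a::{field_gcd, finite} poly set"
  assumes "l \<le> n" "F \<subseteq> monic_polys n" "intersecting l F"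
  shows "card F \<le> CARD('a) ^ (n - l)"
proof -
  define h :: "'a poly" where "h = monom 1 l"
  have h: "h \<in> monic_polys l" "h \<noteq> 0" "degree h = l"
    by (simp_all add: h_def monic_polys_def degree_monom_eq)
  have mod_less: "f mod h = 0 \<or> degree (f mod h) < l" for f
    using degree_mod_less[OF h(2), of f] h(3) by simp
  \<comment> \<open>Subtracting the remainder modulo \<open>x ^ l\<close> erases the
    \<open>l\<close> lowest coefficients. The result is a monic multiple of \<open>x ^ l\<close>,
    and \<open>q ^ (n - l)\<close> of these have degree \<open>n\<close>.\<close>
  have "inj_on (\<lambda>f. f - f mod h) F"
  proof (rule inj_onI)
    fix f f' assume "f \<in> F" "f' \<in> F" and eq: "f - f mod h = f' - f' mod h"
    have "f - f' = f mod h - f' mod h"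
      using eq by (simp add: algebra_simps)
    also have "\<dots> = 1 * ((f - f') mod h)"
      by (simp add: poly_mod_diff_left)
    finally show "f = f'"
      using mod_less[of "f - f'"] \<open>f \<in> F\<close> \<open>f' \<in> F\<close>
      by (intro intersecting_eqI[OF assms(3), of f f' 1]) auto
  qed
  moreover have "(\<lambda>f. f - f mod h) ` F \<subseteq> {f \<in> monic_polys n. h dvd f}"
  proof (clarify, intro conjI)
    fix f assume "f \<in> F"
    then show "f - f mod h \<in> monic_polys n"
      using monic_polys_add[of f n "- (f mod h)"] mod_less[of f] assms(1,2) by auto
    show "h dvd f - f mod h"
      by (simp add: dvd_minus_mod)
  qed
  ultimately have "card F \<le> card {f \<in> monic_polys n. h dvd f}"
    by (intro card_inj_on_le) auto
  then show ?thesis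
    using card_monic_multiples[OF h(1) assms(1)] by simp
qed

section \<open>Extremal families and prime divisors of degree \<open>n - l\<close>\<close>

lemma extremal_contains_multiple:
  fixes F :: "'a::{field_gcd, finite} poly set"
  assumes "l < n" "F \<subseteq> monic_polys n" "intersecting l F" "card F = CARD('a) ^ (n - l)"
    and P: "P \<in> prime_polys (n - l)"
  obtains g where "g \<in> monic_polys l" "g * P \<in> F"
proof -
  have "\<exists>f\<in>F. P dvd f"
  proof (rule ccontr)
    assume none: "\<not> (\<exists>f\<in>F. P dvd f)"
    \<comment> \<open>Adding \<open>P\<close> turns residues into monic polynomials of degree
      \<open>n - l\<close>, which are already counted; the zero residue corresponds to
      \<open>P\<close> itself.\<close>
    have "inj_on (\<lambda>f. P + f mod P) F"
    proof (rule inj_onI)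
      fix f f' assume f: "f \<in> F" "f' \<in> F" and "P + f mod P = P + f' mod P"
      then have "P dvd f - f'"
        by (simp add: mod_eq_dvd_iff)
      then obtain r where r: "f - f' = P * r" ..
      \<comment> \<open>The leading terms of \<open>f\<close> and \<open>f'\<close> cancel, so
        \<open>P * r\<close> has degree below \<open>n = (n - l) + l\<close>.\<close>
      have "degree r < l" if "r \<noteq> 0"
      proof -
        have "degree (f - f') = (n - l) + degree r"
          using that prime_polysD(2)[OF P] monic_polysD(3)[OF prime_polysD(3)[OF P]]
          unfolding r by (simp add: degree_mult_eq)
        moreover have "degree (f - f') < n"
        proof (rule degree_diff_monic_polys)
          show "f \<noteq> f'"
            using r that prime_polysD(1)[OF P] by auto
        qed (use f assms(2) in auto)
        ultimately show ?thesis by simp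
      qed
      moreover have "coprime f P"
        using none f(1) prime_imp_coprime[OF prime_polysD(1)[OF P], of f]
        by (simp add: coprime_commute)
      ultimately show "f = f'"
        using intersecting_eqI[OF assms(3) f _ r] by blast
    qed
    moreover have "(\<lambda>f. P + f mod P) ` F \<subseteq> monic_polys (n - l) - {P}"
    proof clarify
      fix f assume "f \<in> F"
      then have "f mod P \<noteq> 0"
        using none by (auto simp: mod_eq_0_iff_dvd)
      moreover have "P + f mod P \<in> monic_polys (n - l)"
        using prime_polysD[OF P] degree_mod_less[of P f] by (intro monic_polys_add) auto
      ultimately show "P + f mod P \<in> monic_polys (n - l) - {P}"
        by simp
    qed
    ultimately have "card F \<le> card (monic_polys (n - l) - {P})"
      by (intro card_inj_on_le) auto
    also have "\<dots> < card (monic_polys (n - l) :: 'a poly set)"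
      using prime_polysD(3)[OF P] by (intro psubset_card_mono) auto
    finally show False
      using assms(4) by (simp add: card_monic_polys)
  qed
  then obtain f g where f: "f \<in> F" "f = P * g"
    unfolding dvd_def by blast
  then have "g \<in> monic_polys l"
    using mult_in_monic_polys_iff[OF prime_polysD(3)[OF P], of g n] assms(1,2) by auto
  with f show thesis
    using that by (simp add: mult.commute)
qed

text \<open>The gcd of \<open>f\<close> and \<open>g * P\<close> is coprime to \<open>P\<close>, so
  it divides \<open>g\<close>. Its degree is at least \<open>l = degree g\<close>, which makes it an
  associate of \<open>g\<close>.\<close>

lemma cofactor_dvd:
  fixes F :: "'a::field_gcd poly set"
  assumes "intersecting l F" "prime P" "g \<in> monic_polys l" "g * P \<in> F" "f \<in> F" "\<not> P dvd f"
  shows "g dvd f"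
proof -
  define d where "d = gcd f (g * P)"
  have "d dvd f" "d dvd g * P"
    by (simp_all add: d_def)
  have "coprime P f"
    using assms(2,6) by (rule prime_imp_coprime)
  then have "coprime d P"
    using coprime_divisors[OF dvd_refl \<open>d dvd f\<close>] by (simp add: coprime_commute)
  then have "d dvd g"
    using \<open>d dvd g * P\<close> by (simp add: coprime_dvd_mult_left_iff)
  then obtain k where k: "g = d * k" ..
  have "d \<noteq> 0" "k \<noteq> 0"
    using k monic_polysD(3)[OF assms(3)] by auto
  moreover have "l \<le> degree d"
    using assms(1,4,5) by (simp add: d_def intersecting_def)
  ultimately have "degree k = 0"
    using k monic_polysD(1)[OF assms(3)] by (simp add: degree_mult_eq)
  then have "is_unit k"
    using \<open>k \<noteq> 0\<close> by (simp add: is_unit_iff_degree)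
  then have "g dvd d"
    by (simp add: k mult_unit_dvd_iff)
  then show ?thesis
    using \<open>d dvd f\<close> by (rule dvd_trans)
qed

lemma trivial_familyI:
  fixes F :: "'a::{field_gcd, finite} poly set"
  assumes "l \<le> n" "F \<subseteq> monic_polys n" "card F = CARD('a) ^ (n - l)"
    and g: "g \<in> monic_polys l" "\<And>f. f \<in> F \<Longrightarrow> g dvd f"
  shows "trivial_family n l F"
proof -
  have "F = {f \<in> monic_polys n. g dvd f}"
    using assms card_monic_multiples[OF g(1) assms(1)] by (intro card_subset_eq) auto
  also have "\<dots> = {g * p | p. p \<in> monic_polys (n - l)}"
    unfolding monic_multiples_eq[OF g(1) assms(1)] by auto
  finally show ?thesis
    using g(1) unfolding trivial_family_def by blast
qed

lemma trivial_family_if_two_primes: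
  fixes F :: "'a::{field_gcd, finite} poly set" and P P' :: "'a poly"
  assumes "2 * l < n" "F \<subseteq> monic_polys n" "intersecting l F" "card F = CARD('a) ^ (n - l)"
    and P: "P \<in> prime_polys (n - l)" and P': "P' \<in> prime_polys (n - l)" and "P \<noteq> P'"
  shows "trivial_family n l F"
proof -
  have "l < n"
    using assms(1) by simp
  obtain g where g: "g \<in> monic_polys l" "g * P \<in> F"
    using extremal_contains_multiple[OF \<open>l < n\<close> assms(2-4) P] .
  obtain g' where g': "g' \<in> monic_polys l" "g' * P' \<in> F"
    using extremal_contains_multiple[OF \<open>l < n\<close> assms(2-4) P'] .
  note PD = prime_polysD[OF P] and PD' = prime_polysD[OF P']
  \<comment> \<open>This is where \<open>2 * l < n\<close> enters: a prime of degree
    \<open>n - l > l\<close> cannot divide a cofactor of degree \<open>l\<close>.\<close>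
  have large: "\<not> Q dvd h" if "Q \<in> prime_polys (n - l)" "h \<in> monic_polys l" for Q h :: "'a poly"
    using that assms(1) dvd_imp_degree_le[of Q h] monic_polysD[of h l] prime_polysD[of Q "n - l"]
    by auto
  have "\<not> P' dvd P"
    using monic_dvd_eq[OF PD'(3) PD(3)] assms(7) by auto
  then have "\<not> P' dvd g * P"
    using PD'(1) large[OF P' g(1)] by (simp add: prime_dvd_mult_iff)
  then have "g' dvd g * P"
    using cofactor_dvd[OF assms(3) PD'(1) g'] g(2) by blast
  moreover have "coprime g' P"
    using prime_imp_coprime[OF PD(1) large[OF P g'(1)]] by (simp add: coprime_commute)
  ultimately have "g' dvd g"
    by (simp add: coprime_dvd_mult_left_iff)
  then have "g' = g"
    by (rule monic_dvd_eq[OF g'(1) g(1)])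
  show ?thesis
  proof (rule trivial_familyI[OF less_imp_le[OF \<open>l < n\<close>] assms(2,4) g(1)])
    fix f assume "f \<in> F"
    \<comment> \<open>A common multiple of both primes has degree at least
      \<open>2 * (n - l) > n\<close>. So each member avoids one of the primes, and
      \<open>cofactor_dvd\<close> for that prime applies.\<close>
    have "\<not> (P dvd f \<and> P' dvd f)"
    proof
      assume "P dvd f \<and> P' dvd f"
      moreover have "coprime P P'"
        using prime_imp_coprime[OF PD'(1) \<open>\<not> P' dvd P\<close>] by (simp add: coprime_commute)
      ultimately have "P * P' dvd f"
        by (simp add: divides_mult)
      then have "degree (P * P') \<le> degree f"
        using \<open>f \<in> F\<close> assms(2) monic_polysD(3) by (intro dvd_imp_degree_le) auto
      moreover have "degree (P * P') = (n - l) + (n - l)"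
        using PD PD' by (subst degree_mult_eq) auto
      ultimately show False
        using \<open>f \<in> F\<close> assms(1,2) monic_polysD(1)[of f n] by auto
    qed
    then show "g dvd f"
      using cofactor_dvd[OF assms(3) PD(1) g \<open>f \<in> F\<close>] cofactor_dvd[OF assms(3) PD'(1) g' \<open>f \<in> F\<close>]
        \<open>g' = g\<close> by blast
  qed
qed

section \<open>The field with two elements and the exceptional family\<close>

context
  assumes card2: "CARD('a::{field_gcd, finite}) = 2"
begin

lemma UNIV_eq_0_1: "(UNIV :: 'a set) = {0, 1}"
  using card2 by (intro card_subset_eq[symmetric]) auto

lemma char_2: "(2 :: 'a) = 0" "(3 :: 'a) = 1" "- 1 = (1 :: 'a)"
proof -
  have "1 + 1 \<in> {0, 1 :: 'a}"
    unfolding UNIV_eq_0_1[symmetric] by (rule UNIV_I)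
  moreover have "1 + 1 \<noteq> (1 :: 'a)"
    by (simp only: add_cancel_left_right) simp
  ultimately have *: "1 + 1 = (0 :: 'a)"
    by blast
  show "(2 :: 'a) = 0"
    using * by simp
  then show "(3 :: 'a) = 1"
    using numeral_Bit1[of Num.One, where 'a = 'a] by simp
  show "- 1 = (1 :: 'a)"
    using * by (rule minus_unique)
qed

lemma monic_polys_1_eq: "(monic_polys 1 :: 'a poly set) = {[:0, 1:], [:1, 1:]}"
  using UNIV_eq_0_1 by (auto simp: monic_polys_Suc monic_polys_0 one_pCons)

text \<open>In this factored form any two members visibly share \<open>x\<close>,
  \<open>x + 1\<close> or \<open>x ^ 2 + x + 1\<close>. The expanded form below serves to compare
  members and to read off degrees.\<close>

lemma exceptional_family_eq:
  "(exceptional_family :: 'a poly set) =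
     {[:0, 1:] * [:1, 1:] * [:0, 1:], [:0, 1:] * [:1, 1:] * [:1, 1:],
      [:0, 1:] * [:1, 1, 1:], [:1, 1:] * [:1, 1, 1:]}"
  by (simp add: exceptional_family_def Let_def one_pCons power2_eq_square char_2)

lemma exceptional_family_coeffs:
  "(exceptional_family :: 'a poly set) =
     {[:0, 0, 1, 1:], [:0, 1, 0, 1:], [:0, 1, 1, 1:], [:1, 0, 0, 1:]}"
  by (simp add: exceptional_family_eq char_2)

lemma exceptional_family_monic: "(exceptional_family :: 'a poly set) \<subseteq> monic_polys 3"
  by (auto simp: exceptional_family_coeffs monic_polys_def numeral_3_eq_3)

lemma card_exceptional_family: "card (exceptional_family :: 'a poly set) = 4"
  by (simp add: exceptional_family_coeffs)

lemma intersecting_exceptional_family: "intersecting 1 (exceptional_family :: 'a poly set)"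
  unfolding intersecting_def
proof (intro ballI)
  fix p p' :: "'a poly"
  assume p: "p \<in> exceptional_family" "p' \<in> exceptional_family"
  have "\<exists>d\<in>{[:0, 1:], [:1, 1:], [:1, 1, 1:]}. d dvd gcd p p'"
    using p unfolding exceptional_family_eq
    by (elim insertE emptyE) (simp_all only: bex_simps gcd_greatest_iff dvd_triv_left dvd_triv_right dvd_mult2 simp_thms)
  then obtain d where d: "d \<in> {[:0, 1:], [:1, 1:], [:1, 1, 1:]}" "d dvd gcd p p'" ..
  then have "degree d \<ge> 1" by auto
  moreover have "gcd p p' \<noteq> 0"
    using p(1) exceptional_family_monic monic_polysD(3) by (auto simp: gcd_eq_0_iff)
  ultimately show "degree (gcd p p') \<ge> 1"
    using dvd_imp_degree_le[OF d(2)] by linarith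
qed

lemma prime_quadratic: "([:1, 1, 1:] :: 'a poly) \<in> prime_polys 2"
proof -
  let ?P = "[:1, 1, 1:] :: 'a poly"
  have not_dvd: "\<not> a dvd ?P" if "a \<in> monic_polys 1" for a :: "'a poly"
  proof
    assume "a dvd ?P"
    \<comment> \<open>The signs match the shape \<open>[:- c, 1:]\<close> in
      \<open>poly_eq_0_iff_dvd\<close>, so a linear divisor yields a root 0 or 1.\<close>
    moreover have "a = [:- 0, 1:] \<or> a = [:- 1, 1:]"
      using that unfolding monic_polys_1_eq by (simp add: char_2)
    ultimately have "poly ?P 0 = 0 \<or> poly ?P 1 = 0"
      unfolding poly_eq_0_iff_dvd by auto
    then show False
      by (simp add: char_2)
  qed
  have not_dvd': "degree a \<noteq> 1" if "a dvd ?P" for a :: "'a poly"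
  proof
    assume "degree a = 1"
    moreover have "lead_coeff a \<in> {0, 1}"
      unfolding UNIV_eq_0_1[symmetric] by (rule UNIV_I)
    moreover have "lead_coeff a \<noteq> 0"
      using \<open>degree a = 1\<close> by (metis degree_0 leading_coeff_0_iff zero_neq_one)
    ultimately have "a \<in> monic_polys 1"
      unfolding monic_polys_def by blast
    with that not_dvd show False by blast
  qed
  have "irreducible ?P"
  proof (rule irreducibleI)
    fix a b assume ab: "?P = a * b"
    then have "a \<noteq> 0" "b \<noteq> 0" by auto
    then have "degree a + degree b = 2"
      using arg_cong[OF ab, of degree] by (simp add: degree_mult_eq)
    moreover have "degree a \<noteq> 1" "degree b \<noteq> 1"
      using not_dvd'[of a] not_dvd'[of b] unfolding ab by auto
    ultimately have "degree a = 0 \<or> degree b = 0" by linarith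
    then show "is_unit a \<or> is_unit b"
      using \<open>a \<noteq> 0\<close> \<open>b \<noteq> 0\<close> by (simp add: is_unit_iff_degree)
  qed (simp_all add: is_unit_iff_degree)
  then show ?thesis
    by (simp add: prime_polys_def prime_poly_iff)
qed

text \<open>The cofactor of \<open>x ^ 2 + x + 1\<close> in a member can only be \<open>x\<close> or
  \<open>x + 1\<close>. If both occur the family is exceptional; if just one occurs, it divides
  every member.\<close>

lemma trivial_or_exceptional:
  fixes F :: "'a poly set"
  assumes "F \<subseteq> monic_polys 3" "intersecting 1 F" "card F = 4"
  shows "trivial_family 3 1 F \<or> F = exceptional_family"
proof -
  let ?P = "[:1, 1, 1:] :: 'a poly" and ?x = "[:0, 1:] :: 'a poly" and ?y = "[:1, 1:] :: 'a poly"
  note PD = prime_polysD[OF prime_quadratic]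
  have multiple: "\<exists>g\<in>monic_polys 1. f = g * ?P" if f: "f \<in> F" and dvd: "?P dvd f" for f
  proof -
    obtain g where "f = ?P * g"
      using dvd ..
    then show ?thesis
      using f assms(1) mult_in_monic_polys_iff[OF PD(3), of g 3] by (auto simp: mult.commute)
  qed
  show ?thesis
  proof (cases "?x * ?P \<in> F \<and> ?y * ?P \<in> F")
    case True
    have "f \<in> exceptional_family" if "f \<in> F" for f
    proof (cases "?P dvd f")
      case True
      with multiple[OF that] show ?thesis
        unfolding monic_polys_1_eq exceptional_family_eq by blast
    next
      case False
      have "?x \<in> monic_polys 1" "?y \<in> monic_polys 1"
        unfolding monic_polys_1_eq by simp_all
      \<comment> \<open>Both cofactors divide a member that avoids \<open>?P\<close>, so
        \<open>f\<close> is \<open>x * (x + 1)\<close> times a linear factor: one of the two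
        remaining exceptional polynomials.\<close>
      then have "?x dvd f" "?y dvd f"
        using cofactor_dvd[OF assms(2) PD(1)] True that False by blast+
      moreover have "coprime ?x ?y"
        using coprime_add_one_right[of ?x] by (simp add: one_pCons)
      ultimately have "?x * ?y dvd f"
        by (simp only: divides_mult)
      then obtain h where h: "f = ?x * ?y * h" ..
      have "?x * ?y \<in> monic_polys 2"
        by (simp add: monic_polys_def)
      from mult_in_monic_polys_iff[OF this, of h 3] have "h \<in> monic_polys 1"
        using h that assms(1) by auto
      then show ?thesis
        unfolding h monic_polys_1_eq exceptional_family_eq by blast
    qed
    then have "F = exceptional_family"
      using assms(3) card_exceptional_family
      by (intro card_subset_eq) (auto simp: exceptional_family_coeffs)
    then show ?thesis ..
  next
    case False
    obtain g where g: "g \<in> monic_polys 1" "g * ?P \<in> F"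
      using extremal_contains_multiple[of 1 3 F ?P] assms prime_quadratic card2 by auto
    have "g dvd f" if f: "f \<in> F" for f
    proof (cases "?P dvd f")
      case True
      then obtain g' where "g' \<in> monic_polys 1" "f = g' * ?P"
        using multiple[OF f] by blast
      then have "g' = g"
        using False g f unfolding monic_polys_1_eq by blast
      then show ?thesis
        using \<open>f = g' * ?P\<close> by (simp only: dvd_triv_left)
    next
      case False
      then show ?thesis
        by (rule cofactor_dvd[OF assms(2) PD(1) g f])
    qed
    then have "trivial_family 3 1 F"
      using assms g(1) card2 by (intro trivial_familyI) auto
    then show ?thesis ..
  qed
qed

text \<open>A common linear factor would be \<open>x\<close> or \<open>x + 1\<close>, but
  \<open>x ^ 3 + 1\<close> does not vanish at 0, nor \<open>x ^ 3 + x ^ 2 + x\<close> at 1.\<close>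

lemma exceptional_not_trivial: "\<not> trivial_family 3 1 (exceptional_family :: 'a poly set)"
proof
  assume "trivial_family 3 1 (exceptional_family :: 'a poly set)"
  then obtain g :: "'a poly" where g: "g \<in> monic_polys 1"
    and F: "exceptional_family = {g * p | p. p \<in> monic_polys (3 - 1)}"
    unfolding trivial_family_def by blast
  have "g dvd f" if "f \<in> exceptional_family" for f
    using that unfolding F by auto
  then have "g dvd [:0, 1, 1, 1:]" "g dvd [:1, 0, 0, 1:]"
    by (simp_all add: exceptional_family_coeffs)
  moreover have "g = [:- 0, 1:] \<or> g = [:- 1, 1:]"
    using g unfolding monic_polys_1_eq by (simp add: char_2)
  ultimately have "poly [:1, 0, 0, 1:] (0 :: 'a) = 0 \<or> poly [:0, 1, 1, 1:] (1 :: 'a) = 0"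
    unfolding poly_eq_0_iff_dvd by auto
  then show False
    by (simp add: char_2)
qed

end

section \<open>Assembling the cases\<close>

lemma trivial_iff_not_exceptional:
  fixes F :: "'a::{field_gcd, finite} poly set"
  assumes "2 * l < n" "F \<subseteq> monic_polys n" "intersecting l F" "card F = CARD('a) ^ (n - l)"
  shows "trivial_family n l F \<longleftrightarrow> \<not> (CARD('a) = 2 \<and> l = 1 \<and> n = 3 \<and> F = exceptional_family)"
proof (cases "CARD('a) = 2 \<and> n - l = 2")
  case True
  \<comment> \<open>\<open>n = l + 2 > 2 * l\<close> forces \<open>l < 2\<close>. For
    \<open>l = 0\<close> the common divisor 1 already gives triviality, so the exception can arise
    only for \<open>l = 1\<close>.\<close>
  with assms(1) consider "l = 0" "n = 2" | "l = 1" "n = 3"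
    by linarith
  then show ?thesis
  proof cases
    case 1
    then have "trivial_family n l F"
      using assms by (intro trivial_familyI[of _ _ _ 1]) (auto simp: monic_polys_0)
    with 1 show ?thesis by simp
  next
    case 2
    with True assms show ?thesis
      using trivial_or_exceptional[of F] exceptional_not_trivial[where 'a = 'a] by auto
  qed
next
  case False
  then have "2 \<le> card (prime_polys (n - l) :: 'a poly set)"
    using assms(1) by (intro two_prime_polys) auto
  then obtain P P' :: "'a poly" where
    "P \<in> prime_polys (n - l)" "P' \<in> prime_polys (n - l)" "P \<noteq> P'"
    by (auto simp: card_le_Suc_iff numeral_2_eq_2)
  then have "trivial_family n l F"
    by (rule trivial_family_if_two_primes[OF assms])
  moreover have "\<not> (CARD('a) = 2 \<and> l = 1 \<and> n = 3)"
    using False by auto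
  ultimately show ?thesis by blast
qed

theorem theorem1:
  fixes n l q :: nat and F :: "'a::{field_gcd, finite} poly set"
  assumes "CARD('a) = q"
    and "n \<ge> l"
    and "F \<subseteq> monic_polys n"
    and "intersecting l F"
  shows "card F \<le> q ^ (n - l) \<and>
    (n > 2 * l \<and> card F = q ^ (n - l) \<longrightarrow>
      (trivial_family n l F \<longleftrightarrow>
        \<not> (q = 2 \<and> l = 1 \<and> n = 3 \<and> F = exceptional_family))) \<and>
    (q = 2 \<longrightarrow>
      (exceptional_family :: 'a poly set) \<subseteq> monic_polys 3 \<and>
      intersecting 1 (exceptional_family :: 'a poly set) \<and>
      card (exceptional_family :: 'a poly set) = 2 ^ (3 - 1))"
proof (intro conjI impI)
  show "card F \<le> q ^ (n - l)"
    using card_intersecting_le[OF assms(2-4)] assms(1) by simp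
next
  assume "n > 2 * l \<and> card F = q ^ (n - l)"
  then show "trivial_family n l F \<longleftrightarrow> \<not> (q = 2 \<and> l = 1 \<and> n = 3 \<and> F = exceptional_family)"
    using trivial_iff_not_exceptional[of l n F] assms by simp
next
  \<comment> \<open>The exception is genuine: over two elements this family satisfies the hypotheses
    for \<open>n = 3\<close>, \<open>l = 1\<close> and attains the bound.\<close>
  assume "q = 2"
  then have card2: "CARD('a) = 2"
    using assms(1) by simp
  show "(exceptional_family :: 'a poly set) \<subseteq> monic_polys 3"
    by (rule exceptional_family_monic[OF card2])
  show "intersecting 1 (exceptional_family :: 'a poly set)"
    by (rule intersecting_exceptional_family[OF card2])
  show "card (exceptional_family :: 'a poly set) = 2 ^ (3 - 1)"
    using card_exceptional_family[OF card2] by simp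
qed

end
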